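(* Fix $\Phi_0>0$ and $\Phi_0'\in\mathbb R$ and put $\sigma_0:=\Phi_0^2-(\Phi_0')^2$. For real $H\neq0$ with $|H|$ sufficiently small (depending on $\Phi_0,\Phi_0'$), let $(\tilde M,\tilde g)$ be the Kantowski-Sachs perturbation with parameter $H$ of the generalized Nariai solution with parameters $\Phi_0,\Phi_0'$ (and $\Lambda=1$). Then $(\tilde M,\tilde g)$ is locally isometric to a Schwarzschild-de-Sitter solution with $\Lambda=1$ and mass $S=S(H)$, where, as $H\to0$, $$S=\frac13+\frac{\sigma_0}{8}H^2-\Phi_0'\,\frac{2(\Phi_0')^2-3\sigma_0}{24}\,H^3+O(H^4).$$ Consequently, for $|H|>0$ sufficiently small: (i) if $\sigma_0>0$, then $S>1/3$; (ii) if $\sigma_0<0$, then $0<S<1/3$; (iii) if $\sigma_0=0$, then $\Phi_0'H\ne0$, and $0<S<1/3$ if $\Phi_0'H>0$, while $S>1/3$ if $\Phi_0'H<0$.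
   Context: Throughout $\Lambda=1$, and $g_{\mathbb S^2}$ is the round unit metric on $\mathbb S^2$. Generalized Nariai solution with parameters $\Phi_0>0$, $\Phi_0'\in\mathbb R$: the manifold $I\times(\mathbb S^1\times\mathbb S^2)$ with metric $-dt^2+\Phi(t)^2d\rho^2+g_{\mathbb S^2}$, $\Phi(t)=\Phi_0\cosh t+\Phi_0'\sinh t$, where $I\ni0$ is the maximal open interval on which $\Phi>0$. Kantowski-Sachs solutions: metrics $g=2\,ds\,d\mu+F(s)\,d\mu^2+G(s)\,g_{\mathbb S^2}$ in coordinates $s$ and $\mu$ (with $\mu$ on $\mathbb S^1$, or on $\mathbb R$ after passing to the universal cover) solving the vacuum Einstein equations with $\Lambda=1$, which read $$\ddot G-\frac{\dot G^2}{2G}=0,\qquad \ddot F+\frac{\dot F\dot G}{G}-2=0,\qquad 1-\frac1G-\frac{\dot F\dot G}{2G}-\frac{F\dot G^2}{4G^2}=0,$$ the dot denoting $d/ds$. They are determined by the data $F_*=F(0)>0$, $G_*=G(0)>0$, $\dot F_*=\dot F(0)$, $H=\dot G(0)/G(0)$ subject to the last (constraint) equation at $s=0$, and are considered on the maximal $s$-interval containing $0$ on which the solution is defined with $G>0$. For $H=0$ the constraint gives $G_*=1$, and the solution is an analytic extension of the generalized Nariai solution with $\Phi_0=\sqrt{F_*}$, $\Phi_0'=\dot F_*/2$. The Kantowski-Sachs perturbation with parameter $H\neq0$ of the generalized Nariai solution with parameters $\Phi_0,\Phi_0'$ is the Kantowski-Sachs solution with $F_*=\Phi_0^2$, $\dot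 F_*=2\Phi_0'$, the given value of $H$, and $G_*$ determined by the constraint. Schwarzschild-de-Sitter solution with $\Lambda=1$ and mass $S$: locally, in Eddington-Finkelstein coordinates, the metric $$2\,d\hat s\,d\hat\mu+\left(-1+\frac{2S}{\hat s}+\frac{\hat s^2}{3}\right)d\hat\mu^2+\hat s^2 g_{\mathbb S^2},\qquad \hat s>0.$$ *)

theory Defs
  imports "HOL-Analysis.Analysis" "HOL-Library.Landau_Symbols"
begin

(* Smoothness of maps between normed spaces on an open set, by iterating directional derivatives:
   f is of class C^(k+1) iff it is differentiable and x \<mapsto> Df(x)v is of class C^k for every v.
   In finite dimensions, the only case used, this is the usual notion. *)

primrec class_C_on ::
  "nat \<Rightarrow> 'a::real_normed_vector set \<Rightarrow> ('a \<Rightarrow> 'b::real_normed_vector) \<Rightarrow> bool" where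
  "class_C_on 0 U f = continuous_on U f"
| "class_C_on (Suc k) U f =
     ((\<forall>x\<in>U. f differentiable (at x)) \<and>
      (\<forall>v. class_C_on k U (\<lambda>x. frechet_derivative f (at x) v)))"

definition smooth_map_on ::
  "'a::real_normed_vector set \<Rightarrow> ('a \<Rightarrow> 'b::real_normed_vector) \<Rightarrow> bool" where
  "smooth_map_on U f \<longleftrightarrow> open U \<and> (\<forall>k. class_C_on k U f)"

(* A pseudo-Riemannian manifold embedded in a Euclidean space 'a: tangent spaces are linear
   subspaces of 'a, and only the values of the metric on tangent vectors matter. *)

record 'a pseudo_riemannian =
  points :: "'a set"
  tangent :: "'a \<Rightarrow> 'a set"
  metric :: "'a \<Rightarrow> 'a \<Rightarrow> 'a \<Rightarrow> real"

(* Every point of M has an open neighbourhood that is isometric, by a diffeomorphism, to an open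
   subset of N.  Smooth maps between embedded submanifolds are represented by smooth extensions to
   open sets of the ambient spaces; these exist after shrinking the neighbourhoods, and the
   derivative on tangent vectors does not depend on the extension. *)

definition locally_isometric_to ::
  "'a::euclidean_space pseudo_riemannian \<Rightarrow> 'b::euclidean_space pseudo_riemannian \<Rightarrow> bool" where
  "locally_isometric_to M N \<longleftrightarrow>
     (\<forall>p\<in>points M. \<exists>U V \<phi> \<psi>.
        p \<in> U \<and> smooth_map_on U \<phi> \<and> smooth_map_on V \<psi> \<and>
        \<phi> ` (points M \<inter> U) = points N \<inter> V \<and>
        (\<forall>q \<in> points M \<inter> U. \<psi> (\<phi> q) = q) \<and>
        (\<forall>q \<in> points M \<inter> U. \<forall>v \<in> tangent M q. \<forall>w \<in> tangent M q.
           metric N (\<phi> q) (frechet_derivative \<phi> (at q) v) (frechet_derivative \<phi> (at q) w)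
             = metric M q v w))"

(* The metric 2 ds d\<mu> + F(s) d\<mu>^2 + G(s) g_{S^2}, where 2 ds d\<mu> = ds \<otimes> d\<mu> + d\<mu> \<otimes> ds, with s in J and
   S^2 the unit sphere of R^3 with the induced metric.  In the first version \<mu> ranges over the real
   line; in the second one over the circle R/2\<pi>Z, realized as the unit circle of the complex plane
   via z = exp(i\<mu>), so that d\<mu> maps a tangent vector w at z to Im(w/z) = Im(w * cnj z). *)

definition EF_line ::
  "real set \<Rightarrow> (real \<Rightarrow> real) \<Rightarrow> (real \<Rightarrow> real) \<Rightarrow> (real \<times> real \<times> (real^3)) pseudo_riemannian" where
  "EF_line J F G =
     \<lparr>points = J \<times> UNIV \<times> sphere 0 1,
      tangent = (\<lambda>(s, \<mu>, x). UNIV \<times> UNIV \<times> {v. x \<bullet> v = 0}),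
      metric = (\<lambda>(s, \<mu>, x) (a, b, v) (a', b', v').
        a * b' + b * a' + F s * b * b' + G s * (v \<bullet> v'))\<rparr>"

definition EF_circle ::
  "real set \<Rightarrow> (real \<Rightarrow> real) \<Rightarrow> (real \<Rightarrow> real) \<Rightarrow> (real \<times> complex \<times> (real^3)) pseudo_riemannian" where
  "EF_circle J F G =
     \<lparr>points = J \<times> sphere 0 1 \<times> sphere 0 1,
      tangent = (\<lambda>(s, z, x). UNIV \<times> {w. z \<bullet> w = 0} \<times> {v. x \<bullet> v = 0}),
      metric = (\<lambda>(s, z, x) (a, w, v) (a', w', v').
        let b = Im (w * cnj z); b' = Im (w' * cnj z)
        in a * b' + b * a' + F s * b * b' + G s * (v \<bullet> v'))\<rparr>"

definition schwarzschild_de_sitter :: "real \<Rightarrow> (real \<times> real \<times> (real^3)) pseudo_riemannian" where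
  "schwarzschild_de_sitter S = EF_line {0<..} (\<lambda>s. -1 + 2 * S / s + s\<^sup>2 / 3) (\<lambda>s. s\<^sup>2)"

(* The vacuum Einstein equations with \<Lambda> = 1 for the metrics above. *)

definition KS_solution :: "real set \<Rightarrow> (real \<Rightarrow> real) \<Rightarrow> (real \<Rightarrow> real) \<Rightarrow> bool" where
  "KS_solution J F G \<longleftrightarrow>
     open J \<and> is_interval J \<and> 0 \<in> J \<and>
     (\<forall>s\<in>J. G s > 0 \<and>
        F field_differentiable (at s) \<and> deriv F field_differentiable (at s) \<and>
        G field_differentiable (at s) \<and> deriv G field_differentiable (at s) \<and>
        deriv (deriv G) s - (deriv G s)\<^sup>2 / (2 * G s) = 0 \<and>
        deriv (deriv F) s + deriv F s * deriv G s / G s - 2 = 0 \<and>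
        1 - 1 / G s - deriv F s * deriv G s / (2 * G s) - F s * (deriv G s)\<^sup>2 / (4 * (G s)\<^sup>2) = 0)"

definition maximal_KS_solution :: "real set \<Rightarrow> (real \<Rightarrow> real) \<Rightarrow> (real \<Rightarrow> real) \<Rightarrow> bool" where
  "maximal_KS_solution J F G \<longleftrightarrow>
     KS_solution J F G \<and>
     (\<forall>J' F' G'. KS_solution J' F' G' \<and> J \<subseteq> J' \<and> (\<forall>s\<in>J. F' s = F s \<and> G' s = G s) \<longrightarrow> J' = J)"

(* G(0) is not prescribed: it is determined by the constraint equation at s = 0.  The values of F
   and G outside J are irrelevant. *)

definition KS_perturbation ::
  "real \<Rightarrow> real \<Rightarrow> real \<Rightarrow> real set \<Rightarrow> (real \<Rightarrow> real) \<Rightarrow> (real \<Rightarrow> real) \<Rightarrow> bool" where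
  "KS_perturbation \<Phi>0 \<Phi>0' H J F G \<longleftrightarrow>
     maximal_KS_solution J F G \<and>
     F 0 = \<Phi>0\<^sup>2 \<and> deriv F 0 = 2 * \<Phi>0' \<and> deriv G 0 / G 0 = H"

end

theory Submission
  imports Defs "HOL-Complex_Analysis.Complex_Analysis" "HOL-Real_Asymp.Real_Asymp"
begin

text \<open>
  The first field equation says that the area radius \<open>R = sqrt G\<close> is affine in \<open>s\<close>, with slope
  \<open>k = R 0 * H / 2 \<noteq> 0\<close>. Hence \<open>R\<close> may serve as the null coordinate, with \<open>\<mu> / k\<close> in place of \<open>\<mu>\<close>, and the
  constraint becomes \<open>d(R * f)/dR = R\<^sup>2 - 1\<close> for \<open>f = k\<^sup>2 * F\<close>, so \<open>f\<close> is the Schwarzschild-de Sitter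
  function and \<open>2 * S\<close> is the integration constant. The constraint at \<open>s = 0\<close> expresses \<open>G 0\<close> by \<open>H\<close>,
  which gives \<open>S\<close> in closed form.
\<close>

section \<open>Smoothness of affine maps with a holomorphic summand\<close>

lemma class_C_on_cong:
  assumes "open U" "\<And>x. x \<in> U \<Longrightarrow> f x = g x"
  shows "class_C_on k U f \<longleftrightarrow> class_C_on k U g"
  using assms(2)
proof (induction k arbitrary: f g)
  case 0
  then show ?case by (auto cong: continuous_on_cong)
next
  case (Suc k)
  \<comment> \<open>Near a point of the open set \<open>U\<close> both functions have exactly the
    same derivatives, so differentiability and the choice made by \<open>frechet_derivative\<close>
    carry over together.\<close>
  have deriv_iff: "(f has_derivative D) (at x) \<longleftrightarrow> (g has_derivative D) (at x)" if "x \<in> U" for x D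
    using has_derivative_transform_within_open[OF _ assms(1) that, of f D UNIV g]
      has_derivative_transform_within_open[OF _ assms(1) that, of g D UNIV f] Suc.prems
    by auto
  have "class_C_on k U (\<lambda>x. frechet_derivative f (at x) v)
      \<longleftrightarrow> class_C_on k U (\<lambda>x. frechet_derivative g (at x) v)" for v
    by (rule Suc.IH) (simp add: deriv_iff frechet_derivative_def)
  then show ?case
    by (auto simp: differentiable_def deriv_iff)
qed

lemma has_derivative_affine_plus_holomorphic:
  assumes "h field_differentiable at (A p)" "bounded_linear M" "bounded_linear L" "bounded_linear A"
  shows "((\<lambda>p. c + M p + L (h (A p))) has_derivative (\<lambda>v. M v + L (deriv h (A p) * A v))) (at p)"
proof -
  have "(h has_derivative (*) (deriv h (A p))) (at (A p))"
    using assms(1) by (simp add: field_differentiable_derivI has_field_derivative_imp_has_derivative)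
  from diff_chain_at[OF bounded_linear_imp_has_derivative[OF assms(4)] this]
  have "((\<lambda>p. h (A p)) has_derivative (\<lambda>v. deriv h (A p) * A v)) (at p)"
    by (simp add: o_def)
  from bounded_linear.has_derivative[OF assms(3) this]
  show ?thesis
    by (auto intro!: derivative_eq_intros bounded_linear_imp_has_derivative[OF assms(2)])
qed

text \<open>Directional derivatives of such maps have the same shape, so one induction reaches every
  order. The isometries below and their inverses are affine, up to a branch of \<open>Ln\<close> or
  an \<open>exp\<close>, and hence are covered.\<close>

lemma smooth_map_on_affine_plus_holomorphic:
  assumes "open U" "open W" "A ` U \<subseteq> W" "h holomorphic_on W"
    and "bounded_linear M" "bounded_linear L" "bounded_linear A"
  shows "smooth_map_on U (\<lambda>p. c + M p + L (h (A p)))"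
proof -
  have diff: "g field_differentiable at (A p)" if "g holomorphic_on W" "p \<in> U" for g p
    using that assms(2,3) by (auto simp: holomorphic_on_open field_differentiable_def)
  have "class_C_on k U (\<lambda>p. c + M p + L (h (A p)))" for k
    using assms(4,5)
  proof (induction k arbitrary: c M h)
    case 0
    have "isCont (\<lambda>p. c + M p + L (h (A p))) p" if "p \<in> U" for p
      by (rule has_derivative_continuous[OF
          has_derivative_affine_plus_holomorphic[OF diff[OF 0(1) that] 0(2) assms(6,7)]])
    then show ?case
      by (simp add: continuous_at_imp_continuous_on)
  next
    case (Suc k)
    note D = has_derivative_affine_plus_holomorphic[OF diff[OF Suc.prems(1)] Suc.prems(2) assms(6,7)]
    have "class_C_on k U (\<lambda>p. frechet_derivative (\<lambda>p. c + M p + L (h (A p))) (at p) v)" for v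
    proof -
      have "(\<lambda>z. deriv h z * A v) holomorphic_on W"
        using Suc.prems(1) assms(2) by (intro holomorphic_intros holomorphic_deriv)
      \<comment> \<open>The constant becomes \<open>M v\<close>, the linear part zero and
        \<open>h\<close> becomes \<open>\<lambda>z. deriv h z * A v\<close>; hence the
        generalisation over \<open>c\<close>, \<open>M\<close> and \<open>h\<close>.\<close>
      from Suc.IH[OF this bounded_linear_zero, of "M v"]
      show ?thesis
        by (subst class_C_on_cong[OF assms(1)]) (auto simp: frechet_derivative_at[OF D, symmetric])
    qed
    then show ?case
      using D by (auto simp: differentiable_def)
  qed
  then show ?thesis
    using assms(1) by (simp add: smooth_map_on_def)
qed

section \<open>Local isometries onto Schwarzschild-de Sitter\<close>

lemma open_affine_image:
  fixes r k :: real
  assumes "open J" "k \<noteq> 0"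
  shows "open ((\<lambda>s. r + k * s) ` J)"
proof -
  have "(\<lambda>s. r + k * s) ` J = (\<lambda>t. (t - r) / k) -` J"
    using assms(2) by (force simp: field_simps image_iff)
  then show ?thesis
    using assms by (auto intro!: open_vimage continuous_intros)
qed

text \<open>In both cases the isometry rescales \<open>s\<close> to the area radius and the angular coordinate by the
  inverse factor; on the circle the angular coordinate is a branch of the argument near \<open>z0\<close>.\<close>

lemma EF_line_locally_isometric_to_schwarzschild_de_sitter:
  assumes J: "open J" and k: "k \<noteq> 0"
    and pos: "\<And>s. s \<in> J \<Longrightarrow> 0 < r + k * s"
    and G: "\<And>s. s \<in> J \<Longrightarrow> G s = (r + k * s)\<^sup>2"
    and F: "\<And>s. s \<in> J \<Longrightarrow> k\<^sup>2 * F s = -1 + 2 * S / (r + k * s) + (r + k * s)\<^sup>2 / 3"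
  shows "locally_isometric_to (EF_line J F G) (schwarzschild_de_sitter S)"
  unfolding locally_isometric_to_def
proof
  fix p assume p: "p \<in> points (EF_line J F G)"
  define U :: "(real \<times> real \<times> (real^3)) set" where "U = J \<times> UNIV"
  define V :: "(real \<times> real \<times> (real^3)) set" where "V = (\<lambda>s. r + k * s) ` J \<times> UNIV"
  define \<phi> :: "real \<times> real \<times> (real^3) \<Rightarrow> real \<times> real \<times> (real^3)"
    where "\<phi> = (\<lambda>(s, \<mu>, x). (r + k * s, \<mu> / k, x))"
  define \<psi> :: "real \<times> real \<times> (real^3) \<Rightarrow> real \<times> real \<times> (real^3)"
    where "\<psi> = (\<lambda>(s, \<mu>, x). ((s - r) / k, k * \<mu>, x))"
  define M :: "real \<times> real \<times> (real^3) \<Rightarrow> real \<times> real \<times> (real^3)"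
    where "M = (\<lambda>p. (k * fst p, fst (snd p) / k, snd (snd p)))"
  define M' :: "real \<times> real \<times> (real^3) \<Rightarrow> real \<times> real \<times> (real^3)"
    where "M' = (\<lambda>p. (fst p / k, k * fst (snd p), snd (snd p)))"
  have M: "bounded_linear M" and M': "bounded_linear M'"
    unfolding linear_conv_bounded_linear[symmetric]
    by (auto simp: M_def M'_def linear_iff algebra_simps add_divide_distrib)
  have open_UV: "open U" "open V"
    using J k by (auto simp: U_def V_def intro!: open_Times open_affine_image)
  \<comment> \<open>The final \<open>0\<close> is the summand \<open>L (h (A p))\<close> with
    \<open>L\<close>, \<open>h\<close> and \<open>A\<close> all zero.\<close>
  have \<phi>_eq: "\<phi> = (\<lambda>p. (r, 0, 0) + M p + 0)"
    by (auto simp: \<phi>_def M_def)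
  have \<psi>_eq: "\<psi> = (\<lambda>p. (- r / k, 0, 0) + M' p + 0)"
    using k by (auto simp: \<psi>_def M'_def field_simps)
  have smooth: "smooth_map_on U \<phi>" "smooth_map_on V \<psi>"
    unfolding \<phi>_eq \<psi>_eq
    using smooth_map_on_affine_plus_holomorphic[OF open_UV(1) open_UNIV _ _ M bounded_linear_zero
        bounded_linear_zero, of "\<lambda>_. 0"]
      smooth_map_on_affine_plus_holomorphic[OF open_UV(2) open_UNIV _ _ M' bounded_linear_zero
        bounded_linear_zero, of "\<lambda>_. 0"]
    by auto
  have inverse: "\<psi> (\<phi> q) = q" "\<phi> (\<psi> q) = q" for q
    using k by (auto simp: \<phi>_def \<psi>_def split: prod.splits)
  have image: "\<phi> ` (points (EF_line J F G) \<inter> U) = points (schwarzschild_de_sitter S) \<inter> V"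
  proof (intro equalityI subsetI)
    fix q assume "q \<in> \<phi> ` (points (EF_line J F G) \<inter> U)"
    then show "q \<in> points (schwarzschild_de_sitter S) \<inter> V"
      using pos by (auto simp: EF_line_def schwarzschild_de_sitter_def \<phi>_def U_def V_def)
  next
    fix q assume "q \<in> points (schwarzschild_de_sitter S) \<inter> V"
    then have "\<psi> q \<in> points (EF_line J F G) \<inter> U"
      using k by (auto simp: EF_line_def schwarzschild_de_sitter_def \<psi>_def U_def V_def)
    then show "q \<in> \<phi> ` (points (EF_line J F G) \<inter> U)"
      using inverse(2)[of q] by force
  qed
  have "(\<phi> has_derivative M) (at q)" for q
    unfolding \<phi>_eq by (auto intro!: derivative_eq_intros bounded_linear_imp_has_derivative[OF M])
  then have D: "frechet_derivative \<phi> (at q) = M" for q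
    by (rule frechet_derivative_at[symmetric])
  have isometry: "metric (schwarzschild_de_sitter S) (\<phi> q)
      (frechet_derivative \<phi> (at q) v) (frechet_derivative \<phi> (at q) w)
      = metric (EF_line J F G) q v w" if "q \<in> points (EF_line J F G) \<inter> U" for q v w
  proof -
    obtain s \<mu> x where q: "q = (s, \<mu>, x)" by (cases q) auto
    obtain a b y where v: "v = (a, b, y)" by (cases v) auto
    obtain a' b' y' where w: "w = (a', b', y')" by (cases w) auto
    have s: "s \<in> J" using that q by (simp add: U_def)
    \<comment> \<open>The cross terms are invariant since \<open>k\<close> and \<open>1 / k\<close>
      cancel. The angular coefficient is divided by \<open>k\<^sup>2\<close>, which leaves
      \<open>F s\<close>.\<close>
    have "(-1 + 2 * S / (r + k * s) + (r + k * s)\<^sup>2 / 3) * (b / k) * (b' / k) = F s * b * b'"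
      unfolding F[OF s, symmetric] using k by (simp add: power2_eq_square)
    then show ?thesis
      unfolding v w D using k by (simp add: q M_def \<phi>_def EF_line_def schwarzschild_de_sitter_def G[OF s])
  qed
  show "\<exists>U V \<phi> \<psi>. p \<in> U \<and> smooth_map_on U \<phi> \<and> smooth_map_on V \<psi> \<and>
        \<phi> ` (points (EF_line J F G) \<inter> U) = points (schwarzschild_de_sitter S) \<inter> V \<and>
        (\<forall>q \<in> points (EF_line J F G) \<inter> U. \<psi> (\<phi> q) = q) \<and>
        (\<forall>q \<in> points (EF_line J F G) \<inter> U.
          \<forall>v \<in> tangent (EF_line J F G) q. \<forall>w \<in> tangent (EF_line J F G) q.
           metric (schwarzschild_de_sitter S) (\<phi> q)
               (frechet_derivative \<phi> (at q) v) (frechet_derivative \<phi> (at q) w)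
             = metric (EF_line J F G) q v w)"
    using p smooth image inverse(1) isometry
    by (intro exI[of _ U] exI[of _ V] exI[of _ \<phi>] exI[of _ \<psi>]) (auto simp: U_def EF_line_def)
qed

lemma EF_circle_locally_isometric_to_schwarzschild_de_sitter:
  assumes J: "open J" and k: "k \<noteq> 0"
    and pos: "\<And>s. s \<in> J \<Longrightarrow> 0 < r + k * s"
    and G: "\<And>s. s \<in> J \<Longrightarrow> G s = (r + k * s)\<^sup>2"
    and F: "\<And>s. s \<in> J \<Longrightarrow> k\<^sup>2 * F s = -1 + 2 * S / (r + k * s) + (r + k * s)\<^sup>2 / 3"
  shows "locally_isometric_to (EF_circle J F G) (schwarzschild_de_sitter S)"
  unfolding locally_isometric_to_def
proof
  fix p assume p: "p \<in> points (EF_circle J F G)"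
  define z0 where "z0 = fst (snd p)"
  have norm_z0: "norm z0 = 1"
    using p by (auto simp: EF_circle_def z0_def)
  have z0_cnj: "z0 * cnj z0 = 1" "cnj z0 * z0 = 1"
    using norm_z0 complex_norm_square[of z0] by (simp_all add: mult.commute)
  have "z0 \<noteq> 0" using norm_z0 by auto
  \<comment> \<open>On the unit circle \<open>z * cnj z0\<close> is \<open>z / z0\<close>. Its
    positive real part keeps \<open>z\<close> within a quarter turn of \<open>z0\<close> and
    \<open>Ln\<close> off its branch cut; \<open>V\<close> has the matching range of angles.\<close>
  define U :: "(real \<times> complex \<times> (real^3)) set" where "U = J \<times> {z. 0 < Re (z * cnj z0)} \<times> UNIV"
  define V :: "(real \<times> real \<times> (real^3)) set"
    where "V = (\<lambda>s. r + k * s) ` J \<times> {\<mu>. \<bar>k * \<mu>\<bar> < pi / 2} \<times> UNIV"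
  define \<phi> :: "real \<times> complex \<times> (real^3) \<Rightarrow> real \<times> real \<times> (real^3)"
    where "\<phi> = (\<lambda>(s, z, x). (r + k * s, Im (Ln (z * cnj z0)) / k, x))"
  define \<psi> :: "real \<times> real \<times> (real^3) \<Rightarrow> real \<times> complex \<times> (real^3)"
    where "\<psi> = (\<lambda>(s, \<mu>, x). ((s - r) / k, z0 * exp (\<i> * of_real (k * \<mu>)), x))"
  define M :: "real \<times> complex \<times> (real^3) \<Rightarrow> real \<times> real \<times> (real^3)"
    where "M = (\<lambda>p. (k * fst p, 0, snd (snd p)))"
  define L :: "complex \<Rightarrow> real \<times> real \<times> (real^3)" where "L = (\<lambda>z. (0, Im z / k, 0))"
  define A :: "real \<times> complex \<times> (real^3) \<Rightarrow> complex" where "A = (\<lambda>p. fst (snd p) * cnj z0)"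
  define M' :: "real \<times> real \<times> (real^3) \<Rightarrow> real \<times> complex \<times> (real^3)"
    where "M' = (\<lambda>p. (fst p / k, 0, snd (snd p)))"
  define L' :: "complex \<Rightarrow> real \<times> complex \<times> (real^3)" where "L' = (\<lambda>z. (0, z0 * z, 0))"
  define A' :: "real \<times> real \<times> (real^3) \<Rightarrow> complex" where "A' = (\<lambda>p. \<i> * of_real (k * fst (snd p)))"
  have bl: "bounded_linear M" "bounded_linear L" "bounded_linear A"
    and bl': "bounded_linear M'" "bounded_linear L'" "bounded_linear A'"
    unfolding linear_conv_bounded_linear[symmetric]
    by (auto simp: M_def L_def A_def M'_def L'_def A'_def linear_iff algebra_simps
        add_divide_distrib scaleR_conv_of_real)
  have halfplane: "open {z. 0 < Re z}"
    by (simp add: open_halfspace_Re_gt)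
  have "open {z. 0 < Re (z * cnj z0)}" "open {\<mu>. \<bar>k * \<mu>\<bar> < pi / 2}"
    by (intro open_Collect_less continuous_intros)+
  then have open_UV: "open U" "open V"
    using J k by (auto simp: U_def V_def intro!: open_Times open_affine_image)
  have \<phi>_eq: "\<phi> = (\<lambda>p. (r, 0, 0) + M p + L (Ln (A p)))"
    by (auto simp: \<phi>_def M_def L_def A_def)
  have \<psi>_eq: "\<psi> = (\<lambda>p. (- r / k, 0, 0) + M' p + L' (exp (A' p)))"
    using k by (auto simp: \<psi>_def M'_def L'_def A'_def field_simps)
  have Ln_holo: "Ln holomorphic_on {z. 0 < Re z}"
    by (intro holomorphic_intros) (auto simp: complex_nonpos_Reals_iff)
  have A_image: "A ` U \<subseteq> {z. 0 < Re z}"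
    by (auto simp: A_def U_def)
  have smooth: "smooth_map_on U \<phi>" "smooth_map_on V \<psi>"
    unfolding \<phi>_eq \<psi>_eq
    using smooth_map_on_affine_plus_holomorphic[OF open_UV(1) halfplane A_image Ln_holo bl]
      smooth_map_on_affine_plus_holomorphic[OF open_UV(2) open_UNIV _ holomorphic_on_exp bl']
    by auto
  have exp_Im_Ln: "exp (\<i> * of_real (Im (Ln w))) = w" if "norm w = 1" for w
  proof -
    have "w \<noteq> 0" using that by auto
    then have "Ln w = \<i> * of_real (Im (Ln w))"
      using that by (simp add: complex_eq_iff)
    then show ?thesis
      using exp_Ln[OF \<open>w \<noteq> 0\<close>] by simp
  qed
  \<comment> \<open>This is restricted to points of the manifold because \<open>\<phi>\<close>
    forgets the modulus of \<open>z\<close>.\<close>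
  have inverse1: "\<psi> (\<phi> q) = q" if "q \<in> points (EF_circle J F G)" for q
  proof -
    obtain s z x where q: "q = (s, z, x)" by (cases q) auto
    have "norm (z * cnj z0) = 1"
      using that norm_z0 by (auto simp: q EF_circle_def norm_mult)
    moreover have "z0 * (z * cnj z0) = z"
      using z0_cnj(1) by (simp add: mult.left_commute)
    ultimately show ?thesis
      using k exp_Im_Ln[of "z * cnj z0"] by (simp add: q \<phi>_def \<psi>_def)
  qed
  have inverse2: "\<phi> (\<psi> q) = q" if "q \<in> V" for q
  proof -
    obtain s \<mu> x where q: "q = (s, \<mu>, x)" by (cases q) auto
    have \<mu>: "\<bar>k * \<mu>\<bar> < pi / 2"
      using that by (simp add: q V_def)
    have Ln_eq: "Ln (exp (\<i> * of_real (k * \<mu>))) = \<i> * of_real (k * \<mu>)"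
      by (rule Ln_exp) (use \<mu> pi_gt_zero in \<open>auto simp: abs_less_iff\<close>)
    have "z0 * exp (\<i> * of_real (k * \<mu>)) * cnj z0 = exp (\<i> * of_real (k * \<mu>))"
      using z0_cnj(1) by (simp add: mult.commute mult.left_commute)
    with Ln_eq have "Ln (z0 * exp (\<i> * of_real (k * \<mu>)) * cnj z0) = \<i> * of_real (k * \<mu>)"
      by (simp only:)
    then show ?thesis
      using k by (simp add: q \<phi>_def \<psi>_def)
  qed
  have image: "\<phi> ` (points (EF_circle J F G) \<inter> U) = points (schwarzschild_de_sitter S) \<inter> V"
  proof (intro equalityI subsetI)
    fix q assume "q \<in> \<phi> ` (points (EF_circle J F G) \<inter> U)"
    then obtain s z x where q: "q = \<phi> (s, z, x)" and
      mem: "(s, z, x) \<in> points (EF_circle J F G) \<inter> U" by auto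
    have "0 < Re (z * cnj z0)"
      using mem by (simp add: U_def)
    then have "\<bar>Im (Ln (z * cnj z0))\<bar> < pi / 2"
      by (subst Re_Ln_pos_lt) auto
    then show "q \<in> points (schwarzschild_de_sitter S) \<inter> V"
      using mem pos k
      by (auto simp: q EF_circle_def EF_line_def schwarzschild_de_sitter_def \<phi>_def U_def V_def)
  next
    fix q assume q: "q \<in> points (schwarzschild_de_sitter S) \<inter> V"
    obtain s \<mu> x where q_eq: "q = (s, \<mu>, x)" by (cases q) auto
    have \<mu>: "\<bar>k * \<mu>\<bar> < pi / 2"
      using q by (simp add: q_eq V_def)
    have "z0 * exp (\<i> * of_real (k * \<mu>)) * cnj z0 = exp (\<i> * of_real (k * \<mu>))"
      using z0_cnj(1) by (simp add: mult.commute mult.left_commute)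
    moreover have "0 < cos (k * \<mu>)"
      using \<mu> by (intro cos_gt_zero_pi) (auto simp: abs_less_iff)
    ultimately have "0 < Re (z0 * exp (\<i> * of_real (k * \<mu>)) * cnj z0)"
      by (simp only:) (simp add: Re_exp)
    moreover have "norm (z0 * exp (\<i> * of_real (k * \<mu>))) = 1"
      using norm_z0 by (simp add: norm_mult)
    ultimately have "\<psi> q \<in> points (EF_circle J F G) \<inter> U"
      using q k
      by (auto simp: q_eq EF_circle_def EF_line_def schwarzschild_de_sitter_def \<psi>_def U_def V_def)
    then show "q \<in> \<phi> ` (points (EF_circle J F G) \<inter> U)"
      using inverse2[of q] q by force
  qed
  have isometry: "metric (schwarzschild_de_sitter S) (\<phi> q)
      (frechet_derivative \<phi> (at q) v) (frechet_derivative \<phi> (at q) w)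
      = metric (EF_circle J F G) q v w" if mem: "q \<in> points (EF_circle J F G) \<inter> U" for q v w
  proof -
    obtain s z x where q: "q = (s, z, x)" by (cases q) auto
    obtain a c y where v: "v = (a, c, y)" by (cases v) auto
    obtain a' c' y' where w: "w = (a', c', y')" by (cases w) auto
    have s: "s \<in> J" and Re_pos: "0 < Re (z * cnj z0)" and "norm z = 1"
      using mem by (auto simp: q U_def EF_circle_def)
    then have "z \<noteq> 0" "z * cnj z = 1"
      using complex_norm_square[of z] by auto
    then have cnj_z: "cnj z = inverse z"
      by (metis inverse_unique)
    have not_nonpos: "A q \<notin> \<real>\<^sub>\<le>\<^sub>0"
      using Re_pos by (auto simp: q A_def complex_nonpos_Reals_iff)
    have "(\<phi> has_derivative (\<lambda>v. M v + L (deriv Ln (A q) * A v))) (at q)"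
      unfolding \<phi>_eq
      by (intro has_derivative_affine_plus_holomorphic bl field_differentiable_at_Ln not_nonpos)
    then have "frechet_derivative \<phi> (at q) = (\<lambda>v. M v + L (deriv Ln (A q) * A v))"
      by (rule frechet_derivative_at[symmetric])
    moreover have "deriv Ln (A q) = inverse (A q)"
      using has_field_derivative_Ln[OF not_nonpos] by (rule DERIV_imp_deriv)
    \<comment> \<open>The reference point \<open>z0\<close> cancels, leaving \<open>c / z\<close>,
      whose imaginary part is the angular form used in \<open>EF_circle\<close>.\<close>
    moreover have "inverse (A q) * A (a, c, y) = c * cnj z" for a c y
      using \<open>z0 \<noteq> 0\<close> \<open>z \<noteq> 0\<close> by (simp add: q A_def cnj_z field_simps)
    ultimately have "frechet_derivative \<phi> (at q) (a, c, y) = M (a, c, y) + L (c * cnj z)" for a c y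
      by (simp only:)
    then have D: "frechet_derivative \<phi> (at q) (a, c, y) = (k * a, Im (c * cnj z) / k, y)" for a c y
      by (simp add: M_def L_def)
    have "(-1 + 2 * S / (r + k * s) + (r + k * s)\<^sup>2 / 3) * (b / k) * (b' / k) = F s * b * b'" for b b'
      unfolding F[OF s, symmetric] using k by (simp add: power2_eq_square)
    then have "metric (schwarzschild_de_sitter S) (\<phi> q) (k * a, b / k, y) (k * a', b' / k, y')
        = a * b' + b * a' + F s * b * b' + G s * (y \<bullet> y')" for b b'
      using k by (simp add: q \<phi>_def EF_line_def schwarzschild_de_sitter_def G[OF s])
    then show ?thesis
      unfolding v w D by (simp add: q Let_def EF_circle_def)
  qed
  have "0 < Re (z0 * cnj z0)"
    by (simp only: z0_cnj one_complex.sel)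
  then have "p \<in> U"
    using p by (auto simp: U_def EF_circle_def z0_def)
  then show "\<exists>U V \<phi> \<psi>. p \<in> U \<and> smooth_map_on U \<phi> \<and> smooth_map_on V \<psi> \<and>
        \<phi> ` (points (EF_circle J F G) \<inter> U) = points (schwarzschild_de_sitter S) \<inter> V \<and>
        (\<forall>q \<in> points (EF_circle J F G) \<inter> U. \<psi> (\<phi> q) = q) \<and>
        (\<forall>q \<in> points (EF_circle J F G) \<inter> U.
          \<forall>v \<in> tangent (EF_circle J F G) q. \<forall>w \<in> tangent (EF_circle J F G) q.
           metric (schwarzschild_de_sitter S) (\<phi> q)
               (frechet_derivative \<phi> (at q) v) (frechet_derivative \<phi> (at q) w)
             = metric (EF_circle J F G) q v w)"
    using smooth image inverse1 isometry
    by (intro exI[of _ U] exI[of _ V] exI[of _ \<phi>] exI[of _ \<psi>]) auto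
qed

section \<open>Kantowski-Sachs solutions in terms of the area radius\<close>

text \<open>Two quantities are constant on the interval \<open>J\<close>: the slope \<open>k\<close>
  of the radius \<open>R\<close>, and \<open>R * (k\<^sup>2 * F) - R^3 / 3 + R\<close>, with value
  \<open>2 * S\<close>. Both are therefore read off at \<open>s = 0\<close>.\<close>

lemma KS_solution_area_radius:
  assumes sol: "KS_solution J F G"
  defines "r \<equiv> sqrt (G 0)"
  defines "k \<equiv> r * (deriv G 0 / G 0) / 2"
  defines "S \<equiv> r / 2 * (k\<^sup>2 * F 0 - r\<^sup>2 / 3 + 1)"
  assumes "s \<in> J"
  shows "0 < r + k * s" "G s = (r + k * s)\<^sup>2"
    "k\<^sup>2 * F s = -1 + 2 * S / (r + k * s) + (r + k * s)\<^sup>2 / 3"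
proof -
  have J: "open J" "convex J" "0 \<in> J"
    using sol by (auto simp: KS_solution_def is_interval_convex_1)
  have pos: "G s > 0"
    and dF: "(F has_real_derivative deriv F s) (at s)"
    and dG: "(G has_real_derivative deriv G s) (at s)"
    and ddG: "(deriv G has_real_derivative (deriv G s)\<^sup>2 / (2 * G s)) (at s)"
    and constraint: "1 - 1 / G s - deriv F s * deriv G s / (2 * G s)
      - F s * (deriv G s)\<^sup>2 / (4 * (G s)\<^sup>2) = 0" if "s \<in> J" for s
    using sol that field_differentiable_derivI[of "deriv G" s]
    by (auto simp: KS_solution_def field_differentiable_derivI)
  define R where "R = (\<lambda>s. sqrt (G s))"
  have R_pos: "R s > 0" and G_eq: "G s = (R s)\<^sup>2" if "s \<in> J" for s
    using pos[OF that] by (auto simp: R_def)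
  have dR: "(R has_real_derivative deriv G s / (2 * R s)) (at s)" if "s \<in> J" for s
    unfolding R_def using pos[OF that]
    by (auto intro!: derivative_eq_intros dG that simp: field_simps)
  \<comment> \<open>The quotient is the derivative of \<open>R\<close>; substituting
    \<open>G = R\<^sup>2\<close> turns the first field equation into the vanishing of the second
    derivative of \<open>R\<close>.\<close>
  have "((\<lambda>s. deriv G s / (2 * R s)) has_real_derivative 0) (at s)" if "s \<in> J" for s
  proof -
    have "((\<lambda>s. deriv G s / (2 * R s)) has_real_derivative
        ((deriv G s)\<^sup>2 / (2 * (R s)\<^sup>2) * (2 * R s) - deriv G s * (2 * (deriv G s / (2 * R s))))
          / ((2 * R s) * (2 * R s))) (at s)"
      using R_pos[OF that] ddG[OF that] unfolding G_eq[OF that]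
      by (intro DERIV_divide DERIV_cmult dR that) auto
    then show ?thesis
      using R_pos[OF that] by (simp add: power2_eq_square)
  qed
  then obtain c where c: "\<forall>s\<in>J. deriv G s / (2 * R s) = c"
    using has_field_derivative_zero_constant[OF J(2), of "\<lambda>s. deriv G s / (2 * R s)"]
    by (auto intro: has_field_derivative_at_within)
  have "deriv G 0 / (2 * R 0) = k"
    using G_eq[OF J(3)] R_pos[OF J(3)]
    by (auto simp: k_def r_def R_def[symmetric] field_simps power2_eq_square)
  then have k_eq: "deriv G s / (2 * R s) = k" if "s \<in> J" for s
    using that J(3) c by auto
  then have dR': "(R has_real_derivative k) (at s)" if "s \<in> J" for s
    using dR[OF that] k_eq[OF that] by simp
  have "((\<lambda>s. R s - k * s) has_real_derivative 0) (at s)" if "s \<in> J" for s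
    using DERIV_diff[OF dR'[OF that] DERIV_cmult_Id[of k]] by simp
  then obtain c' where c': "\<forall>s\<in>J. R s - k * s = c'"
    using has_field_derivative_zero_constant[OF J(2), of "\<lambda>s. R s - k * s"]
    by (auto intro: has_field_derivative_at_within)
  have R_eq: "R s = r + k * s" if "s \<in> J" for s
  proof -
    have "R s - k * s = R 0 - k * 0"
      using c' that J(3) by metis
    then show ?thesis
      by (simp add: r_def R_def)
  qed
  have constraint': "(R s)\<^sup>2 - 1 = R s * k * deriv F s + k\<^sup>2 * F s" if "s \<in> J" for s
  proof -
    have dG_eq: "deriv G s = 2 * R s * k"
      using k_eq[OF that] R_pos[OF that] by (auto simp: field_simps)
    \<comment> \<open>Multiplying the constraint by the squared radius clears its denominators;
      \<open>x\<close>, \<open>d\<close> and \<open>f\<close> stand for \<open>R s\<close>,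
      \<open>deriv F s\<close> and \<open>F s\<close>.\<close>
    have "x\<^sup>2 * (1 - 1 / x\<^sup>2 - d * (2 * x * k) / (2 * x\<^sup>2) - f * (2 * x * k)\<^sup>2 / (4 * (x\<^sup>2)\<^sup>2))
        = x\<^sup>2 - 1 - x * k * d - k\<^sup>2 * f" if "x > 0" for x d f :: real
    proof -
      have "d * (2 * x * k) / (2 * x\<^sup>2) = k * d / x"
        "f * (2 * x * k)\<^sup>2 / (4 * (x\<^sup>2)\<^sup>2) = k\<^sup>2 * f / x\<^sup>2"
        using that by (simp_all add: power2_eq_square)
      then show ?thesis
        using that by (simp add: right_diff_distrib) (simp add: power2_eq_square)
    qed
    from this[OF R_pos[OF that], of "deriv F s" "F s"] show ?thesis
      using constraint[OF that] unfolding dG_eq G_eq[OF that] by simp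
  qed
  \<comment> \<open>The derivative is \<open>k\<close> times the difference of the two sides of
    \<open>constraint'\<close>.\<close>
  have "\<exists>c. \<forall>s\<in>J. R s * (k\<^sup>2 * F s) - (R s)^3 / 3 + R s = c"
  proof (rule has_field_derivative_zero_constant)
    fix s assume s: "s \<in> J"
    have "((\<lambda>s. R s * (k\<^sup>2 * F s) - (R s)^3 / 3 + R s) has_real_derivative
       k * (k\<^sup>2 * F s) + k\<^sup>2 * deriv F s * R s - 3 * (R s)\<^sup>2 * k / 3 + k) (at s)"
      using DERIV_power[OF dR'[OF s], of 3]
      by (intro DERIV_add DERIV_diff DERIV_mult DERIV_cdivide DERIV_cmult dR' dF s)
        (simp add: ac_simps)
    also have "k * (k\<^sup>2 * F s) + k\<^sup>2 * deriv F s * R s - 3 * (R s)\<^sup>2 * k / 3 + k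
        = k * ((R s * k * deriv F s + k\<^sup>2 * F s) - ((R s)\<^sup>2 - 1))"
      by (simp add: right_diff_distrib distrib_left power2_eq_square ac_simps)
    finally show "((\<lambda>s. R s * (k\<^sup>2 * F s) - (R s)^3 / 3 + R s) has_real_derivative 0) (at s within J)"
      unfolding constraint'[OF s] by (simp add: has_field_derivative_at_within)
  qed (rule J(2))
  then obtain m where m: "\<forall>s\<in>J. R s * (k\<^sup>2 * F s) - (R s)^3 / 3 + R s = m"
    by blast
  have "2 * S = r * (k\<^sup>2 * F 0) - r^3 / 3 + r"
    by (simp add: S_def right_diff_distrib distrib_left power2_eq_square power3_eq_cube)
  also have "\<dots> = R s * (k\<^sup>2 * F s) - (R s)^3 / 3 + R s"
    using m[rule_format, OF J(3)] m[rule_format, OF assms(5)] by (simp add: r_def R_def)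
  finally have "k\<^sup>2 * F s = (2 * S + (R s)^3 / 3 - R s) / R s"
    using R_pos[OF assms(5)] by (simp add: eq_divide_eq mult.commute)
  also have "\<dots> = -1 + 2 * S / R s + (R s)\<^sup>2 / 3"
    using R_pos[OF assms(5)]
    by (simp add: add_divide_distrib diff_divide_distrib power2_eq_square power3_eq_cube)
  finally show "k\<^sup>2 * F s = -1 + 2 * S / (r + k * s) + (r + k * s)\<^sup>2 / 3"
    unfolding R_eq[OF assms(5)] .
  show "0 < r + k * s" "G s = (r + k * s)\<^sup>2"
    using R_pos G_eq R_eq assms(5) by auto
qed

text \<open>This converse of the normal form supplies actual solutions. \<open>J\<close> is the
  half-line of positive radius; a larger interval would contain its endpoint, where continuity
  forces \<open>G\<close> to vanish, against positivity.\<close>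

lemma maximal_KS_solution_affine_radius:
  fixes r k S :: real
  assumes "k \<noteq> 0" "r > 0"
  defines "J \<equiv> {s. 0 < r + k * s}"
  defines "F \<equiv> \<lambda>s. (-1 + 2 * S / (r + k * s) + (r + k * s)\<^sup>2 / 3) / k\<^sup>2"
  defines "G \<equiv> \<lambda>s. (r + k * s)\<^sup>2"
  shows "maximal_KS_solution J F G"
    "deriv F 0 = (- 2 * S / r\<^sup>2 + 2 * r / 3) / k" "deriv G 0 = 2 * k * r"
proof -
  have J: "open J" "is_interval J" "0 \<in> J"
  proof -
    show "open J" unfolding J_def by (intro open_Collect_less continuous_intros)
    \<comment> \<open>On the reals the inner product is multiplication, so \<open>J\<close> is a
      half-space and hence convex.\<close>
    have "J = {s. - r < k \<bullet> s}" unfolding J_def by (auto simp: algebra_simps)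
    then show "is_interval J"
      by (simp only: is_interval_convex_1) (rule convex_halfspace_gt)
    show "0 \<in> J" using assms(2) by (simp add: J_def)
  qed
  define F' where "F' = (\<lambda>s. (- 2 * S / (r + k * s)\<^sup>2 + 2 * (r + k * s) / 3) / k)"
  define G' where "G' = (\<lambda>s. 2 * k * (r + k * s))"
  have nz: "r + k * s \<noteq> 0" if "s \<in> J" for s using that by (simp add: J_def)
  have dR: "((\<lambda>s. r + k * s) has_real_derivative k) (at s)" for s
    by (auto intro!: derivative_eq_intros)
  have dF: "(F has_real_derivative F' s) (at s)" if "s \<in> J" for s
  proof -
    have "((\<lambda>x. (-1 + 2 * S / x + x\<^sup>2 / 3) / k\<^sup>2) has_real_derivative
        (- 2 * S / x\<^sup>2 + 2 * x / 3) / k\<^sup>2) (at x)" if "x \<noteq> 0" for x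
      using that assms(1) by (auto intro!: derivative_eq_intros simp: power2_eq_square)
    from DERIV_chain2[OF this[OF nz[OF that]] dR] show ?thesis
      using assms(1) by (simp add: F_def F'_def power2_eq_square)
  qed
  have dG: "(G has_real_derivative G' s) (at s)" for s
    unfolding G_def G'_def by (auto intro!: derivative_eq_intros)
  have ddF: "(F' has_real_derivative 4 * S / (r + k * s)^3 + 2 / 3) (at s)" if "s \<in> J" for s
  proof -
    have "((\<lambda>x. (- 2 * S / x\<^sup>2 + 2 * x / 3) / k) has_real_derivative
        (4 * S / x^3 + 2 / 3) / k) (at x)" if "x \<noteq> 0" for x
      using that assms(1)
      by (auto intro!: derivative_eq_intros simp: field_simps power2_eq_square power3_eq_cube)
    from DERIV_chain2[OF this[OF nz[OF that]] dR] show ?thesis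
      using assms(1) by (simp add: F'_def)
  qed
  have ddG: "(G' has_real_derivative 2 * k\<^sup>2) (at s)" for s
    unfolding G'_def by (auto intro!: derivative_eq_intros simp: power2_eq_square)
  have F'_eq: "deriv F s = F' s" if "s \<in> J" for s
    using dF[OF that] by (rule DERIV_imp_deriv)
  have G'_eq: "deriv G = G'"
    using dG by (auto intro!: ext DERIV_imp_deriv)
  \<comment> \<open>\<open>deriv F\<close> is identified with \<open>F'\<close> only on
    \<open>J\<close>, so the derivative is transferred through this open set.\<close>
  have ddF': "(deriv F has_real_derivative 4 * S / (r + k * s)^3 + 2 / 3) (at s)" if "s \<in> J" for s
    by (rule has_field_derivative_transform_within_open[OF ddF[OF that] J(1) that]) (simp add: F'_eq)
  have "KS_solution J F G"
    unfolding KS_solution_def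
  proof (intro conjI ballI J)
    fix s assume s: "s \<in> J"
    note nz = nz[OF s]
    show "G s > 0" using nz by (simp add: G_def)
    show "F field_differentiable at s" "deriv F field_differentiable at s"
      "G field_differentiable at s" "deriv G field_differentiable at s"
      unfolding G'_eq using dF[OF s] ddF'[OF s] dG ddG by (auto simp: field_differentiable_def)
    show "deriv (deriv G) s - (deriv G s)\<^sup>2 / (2 * G s) = 0"
      unfolding G'_eq DERIV_imp_deriv[OF ddG] using nz by (simp add: G_def G'_def power_mult_distrib)
    show "deriv (deriv F) s + deriv F s * deriv G s / G s - 2 = 0"
    proof -
      have "4 * S / x^3 + 2 / 3 + (- 2 * S / x\<^sup>2 + 2 * x / 3) / k * (2 * k * x) / x\<^sup>2 - 2 = 0"
        if "x \<noteq> 0" for x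
        using that assms(1) by (simp add: field_simps power2_eq_square power3_eq_cube)
      from this[OF nz] show ?thesis
        unfolding DERIV_imp_deriv[OF ddF'[OF s]] F'_eq[OF s] G'_eq
        unfolding G_def F'_def G'_def .
    qed
    show "1 - 1 / G s - deriv F s * deriv G s / (2 * G s) - F s * (deriv G s)\<^sup>2 / (4 * (G s)\<^sup>2) = 0"
    proof -
      have "1 - 1 / x\<^sup>2 - (- 2 * S / x\<^sup>2 + 2 * x / 3) / k * (2 * k * x) / (2 * x\<^sup>2)
          - (-1 + 2 * S / x + x\<^sup>2 / 3) / k\<^sup>2 * (2 * k * x)\<^sup>2 / (4 * (x\<^sup>2)\<^sup>2) = 0" if "x \<noteq> 0" for x
        using that assms(1) by (simp add: field_simps power2_eq_square)
      from this[OF nz] show ?thesis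
        unfolding F'_eq[OF s] G'_eq unfolding G_def F_def F'_def G'_def .
    qed
  qed
  moreover have "J' = J" if sol': "KS_solution J' F1 G1" and sub: "J \<subseteq> J'"
    and agree: "\<forall>s\<in>J. F1 s = F s \<and> G1 s = G s" for J' F1 G1
  proof (rule ccontr)
    assume "J' \<noteq> J"
    then obtain t where "t \<in> J'" "t \<notin> J"
      using sub by blast
    then have t: "t \<in> J'" "r + k * t \<le> 0"
      by (auto simp: J_def)
    \<comment> \<open>The radius vanishes at \<open>e\<close>, which lies in \<open>J'\<close> and in the closure of \<open>J\<close>.\<close>
    define e where "e = - r / k"
    have J': "is_interval J'" "0 \<in> J'"
      using sol' by (auto simp: KS_solution_def)
    have "t \<le> e \<and> e \<le> 0 \<or> 0 \<le> e \<and> e \<le> t"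
    proof (cases "k > 0")
      case True
      then have "t \<le> e"
        unfolding e_def pos_le_divide_eq[OF True] using t(2) by (simp add: mult.commute)
      moreover have "e \<le> 0"
        unfolding e_def using True assms(2) by (simp add: divide_nonpos_pos)
      ultimately show ?thesis by simp
    next
      case False
      then have "k < 0" using assms(1) by simp
      then have "e \<le> t"
        unfolding e_def neg_divide_le_eq[OF \<open>k < 0\<close>] using t(2) by (simp add: mult.commute)
      moreover have "0 \<le> e"
        unfolding e_def using \<open>k < 0\<close> assms(2) by (simp add: divide_nonneg_neg)
      ultimately show ?thesis by simp
    qed
    then have e: "e \<in> J'"
      using J' t(1) mem_is_interval_1_I by blast
    \<comment> \<open>The points run from \<open>0\<close> to \<open>e\<close>; their radius
      \<open>r / real (Suc n)\<close> is positive, so they stay in \<open>J\<close>, where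
      \<open>G1\<close> agrees with \<open>G\<close>.\<close>
    define X where "X = (\<lambda>n. e - e / real (Suc n))"
    have X: "X \<longlonglongrightarrow> e"
      unfolding X_def
      using tendsto_diff[OF tendsto_const[of e] LIMSEQ_Suc[OF lim_const_over_n[of e]]] by (simp only: diff_0_right)
    have X_radius: "r + k * X n = r / real (Suc n)" for n
    proof -
      have "k * e = - r" using assms(1) by (simp add: e_def)
      then show ?thesis by (simp add: X_def right_diff_distrib)
    qed
    have "isCont G1 e"
      using sol' e by (auto simp: KS_solution_def intro: field_differentiable_imp_continuous_at)
    then have "(\<lambda>n. G1 (X n)) \<longlonglongrightarrow> G1 e"
      using X by (rule isCont_tendsto_compose)
    moreover have "G1 (X n) = (r / real (Suc n))\<^sup>2" for n
    proof -
      have "X n \<in> J" using assms(2) by (simp add: J_def X_radius)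
      then show ?thesis using agree by (simp add: G_def X_radius)
    qed
    ultimately have "(\<lambda>n. (r / real (Suc n))\<^sup>2) \<longlonglongrightarrow> G1 e"
      by (simp only:)
    moreover have "(\<lambda>n. (r / real (Suc n))\<^sup>2) \<longlonglongrightarrow> 0\<^sup>2"
      by (intro tendsto_power lim_const_over_n[THEN LIMSEQ_Suc])
    ultimately have "G1 e = 0"
      using LIMSEQ_unique by (metis zero_power2)
    then show False
      using sol' e by (auto simp: KS_solution_def)
  qed
  ultimately show "maximal_KS_solution J F G"
    unfolding maximal_KS_solution_def by blast
  show "deriv F 0 = (- 2 * S / r\<^sup>2 + 2 * r / 3) / k" "deriv G 0 = 2 * k * r"
    using F'_eq[OF J(3)] by (simp_all add: F'_def G'_eq G'_def)
qed

section \<open>The mass as a function of H\<close>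

text \<open>The mass \<open>S(H)\<close>, with \<open>a = \<Phi>0'\<close> and \<open>b = \<Phi>0\<^sup>2\<close>; the radicand is \<open>1 / G 0\<close>.\<close>

definition KS_mass :: "real \<Rightarrow> real \<Rightarrow> real \<Rightarrow> real" where
  "KS_mass a b H = (1 / 3 - a * H / 2) / sqrt (1 - a * H - b * H\<^sup>2 / 4) ^ 3"

text \<open>The right-hand side is the integration constant of the normal form, halved, for
  \<open>k = r * H / 2\<close> and \<open>F 0 = b\<close>.\<close>

lemma KS_mass_eq:
  assumes "0 < 1 - a * H - b * H\<^sup>2 / 4" and r: "r = 1 / sqrt (1 - a * H - b * H\<^sup>2 / 4)"
  shows "KS_mass a b H = r / 2 * ((r * H / 2)\<^sup>2 * b - r\<^sup>2 / 3 + 1)"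
proof -
  define q where "q = sqrt (1 - a * H - b * H\<^sup>2 / 4)"
  have q: "q > 0" "q\<^sup>2 = 1 - a * H - b * H\<^sup>2 / 4"
    using assms(1) by (simp_all add: q_def)
  have "r / 2 * ((r * H / 2)\<^sup>2 * b - r\<^sup>2 / 3 + 1) = (b * H\<^sup>2 / 4 - 1 / 3 + q\<^sup>2) / (2 * q ^ 3)"
    unfolding r q_def[symmetric] using q(1)
    by (simp add: field_simps power2_eq_square power3_eq_cube)
  \<comment> \<open>Inserting \<open>q\<^sup>2\<close> cancels the terms in \<open>b\<close> and
    leaves the numerator \<open>2 / 3 - a * H\<close>.\<close>
  also have "\<dots> = KS_mass a b H"
    unfolding KS_mass_def q_def[symmetric] q(2) using q(1) by (simp add: field_simps)
  finally show ?thesis ..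
qed

text \<open>The constraint at \<open>s = 0\<close> identifies \<open>1 / G 0\<close> with the
  radicand in \<open>KS_mass\<close>. Thus \<open>r\<close>, \<open>k\<close> and the mass depend
  only on \<open>\<Phi>0\<close>, \<open>\<Phi>0'\<close> and \<open>H\<close>, and
  \<open>H \<noteq> 0\<close> makes the rescaling factor \<open>k\<close> nonzero.\<close>

lemma KS_perturbation_locally_isometric:
  assumes pert: "KS_perturbation \<Phi>0 \<Phi>0' H J F G" and "H \<noteq> 0"
  defines "S \<equiv> KS_mass \<Phi>0' (\<Phi>0\<^sup>2) H"
  shows "locally_isometric_to (EF_circle J F G) (schwarzschild_de_sitter S)"
    "locally_isometric_to (EF_line J F G) (schwarzschild_de_sitter S)"
proof -
  have sol: "KS_solution J F G" and F0: "F 0 = \<Phi>0\<^sup>2" "deriv F 0 = 2 * \<Phi>0'"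
    and H: "deriv G 0 / G 0 = H"
    using pert by (auto simp: KS_perturbation_def maximal_KS_solution_def)
  then have J: "open J" "0 \<in> J" and G0: "G 0 > 0"
    and constraint: "1 - 1 / G 0 - deriv F 0 * deriv G 0 / (2 * G 0)
      - F 0 * (deriv G 0)\<^sup>2 / (4 * (G 0)\<^sup>2) = 0"
    by (auto simp: KS_solution_def)
  have "deriv G 0 = H * G 0"
    using H G0 by auto
  then have u: "1 - \<Phi>0' * H - \<Phi>0\<^sup>2 * H\<^sup>2 / 4 = 1 / G 0"
    using constraint G0 by (simp add: F0 power_mult_distrib)
  define r where "r = sqrt (G 0)"
  define k where "k = r * (deriv G 0 / G 0) / 2"
  have r: "r = 1 / sqrt (1 - \<Phi>0' * H - \<Phi>0\<^sup>2 * H\<^sup>2 / 4)" "r > 0"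
    using G0 by (simp_all add: u r_def real_sqrt_divide)
  then have "k \<noteq> 0"
    using \<open>H \<noteq> 0\<close> by (simp add: k_def H)
  have S: "r / 2 * (k\<^sup>2 * F 0 - r\<^sup>2 / 3 + 1) = S"
    using KS_mass_eq[OF _ r(1)] G0 by (simp add: S_def k_def H F0 u)
  note form = KS_solution_area_radius[OF sol, folded r_def, folded k_def, unfolded S]
  show "locally_isometric_to (EF_circle J F G) (schwarzschild_de_sitter S)"
    by (rule EF_circle_locally_isometric_to_schwarzschild_de_sitter[OF J(1) \<open>k \<noteq> 0\<close> form])
  show "locally_isometric_to (EF_line J F G) (schwarzschild_de_sitter S)"
    by (rule EF_line_locally_isometric_to_schwarzschild_de_sitter[OF J(1) \<open>k \<noteq> 0\<close> form])
qed

text \<open>A positive radicand yields an initial radius \<open>r\<close>; the normal form with the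
  resulting \<open>k\<close> and mass then has the prescribed data.\<close>

lemma KS_perturbation_exists:
  assumes "H \<noteq> 0" and u: "0 < 1 - \<Phi>0' * H - \<Phi>0\<^sup>2 * H\<^sup>2 / 4"
  shows "\<exists>J F G. KS_perturbation \<Phi>0 \<Phi>0' H J F G"
proof -
  define r where "r = 1 / sqrt (1 - \<Phi>0' * H - \<Phi>0\<^sup>2 * H\<^sup>2 / 4)"
  define k where "k = r * H / 2"
  define S where "S = KS_mass \<Phi>0' (\<Phi>0\<^sup>2) H"
  define F where "F = (\<lambda>s. (-1 + 2 * S / (r + k * s) + (r + k * s)\<^sup>2 / 3) / k\<^sup>2)"
  define G where "G = (\<lambda>s. (r + k * s)\<^sup>2)"
  have r: "r > 0" "1 / r\<^sup>2 = 1 - \<Phi>0' * H - \<Phi>0\<^sup>2 * H\<^sup>2 / 4"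
    using u by (simp_all add: r_def power_divide)
  then have k: "k \<noteq> 0"
    using assms(1) by (simp add: k_def)
  \<comment> \<open>This value of \<open>S\<close> is the one for which the normal form gives
    \<open>F 0 = \<Phi>0\<^sup>2\<close>.\<close>
  have S: "S = r / 2 * (k\<^sup>2 * \<Phi>0\<^sup>2 - r\<^sup>2 / 3 + 1)"
    unfolding S_def k_def by (rule KS_mass_eq[OF u r_def])
  note sol = maximal_KS_solution_affine_radius(1,2)[OF k r(1), where S = S, folded F_def G_def]
    maximal_KS_solution_affine_radius(3)[OF k r(1), folded G_def]
  have "F 0 = \<Phi>0\<^sup>2"
    using r(1) k by (simp add: F_def S)
  moreover have "deriv F 0 = 2 * \<Phi>0'"
  proof -
    \<comment> \<open>Replacing \<open>1 / r\<^sup>2\<close> by the radicand, which is the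
      constraint at \<open>s = 0\<close>, then produces \<open>\<Phi>0'\<close>.\<close>
    have "- 2 * S / r\<^sup>2 + 2 * r / 3 = r * (1 - 1 / r\<^sup>2 - \<Phi>0\<^sup>2 * H\<^sup>2 / 4)"
      unfolding S k_def using r(1) by (simp add: field_simps power2_eq_square)
    also have "\<dots> = k * (2 * \<Phi>0')"
      unfolding r(2) by (simp add: k_def)
    finally show ?thesis
      using k by (simp add: sol(2))
  qed
  moreover have "deriv G 0 / G 0 = H"
    unfolding sol(3) using r(1) by (simp add: G_def k_def power2_eq_square)
  ultimately show ?thesis
    using sol(1) unfolding KS_perturbation_def by blast
qed

section \<open>Expansion of the mass and its sign near \<open>H = 0\<close>\<close>

lemma tendsto_KS_mass_denominator: "((\<lambda>H. 1 - a * H - b * H\<^sup>2 / 4) \<longlongrightarrow> (1::real)) (at 0)"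
  by (rule tendsto_eq_intros refl | simp)+

text \<open>The mass is \<open>1 / 3 - a * H / 2\<close> times the power -3/2 of
  \<open>1 - x H\<close>. Since \<open>x H\<close> is of order \<open>H\<close>, the cubic Taylor
  polynomial in \<open>x\<close> suffices.\<close>

lemma KS_mass_asymptotics:
  assumes "b > 0"
  shows "(\<lambda>H. KS_mass a b H - (1 / 3 + (b - a\<^sup>2) / 8 * H\<^sup>2
      - a * ((2 * a\<^sup>2 - 3 * (b - a\<^sup>2)) / 24) * H ^ 3)) \<in> O[at 0](\<lambda>H. H ^ 4)"
proof -
  \<comment> \<open>The cubic Taylor polynomial at 0 of the power -3/2 of
    \<open>1 - x\<close>.\<close>
  define P where "P = (\<lambda>x::real. 1 + 3 / 2 * x + 15 / 8 * x ^ 2 + 35 / 16 * x ^ 3)"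
  define x where "x = (\<lambda>H. H * (a + b / 4 * H))"
  have series: "(\<lambda>x. 1 / sqrt (1 - x) ^ 3 - P x) \<in> O[at 0](\<lambda>x. x ^ 4)"
    unfolding P_def by real_asymp
  have x_at_0: "filterlim x (at 0) (at 0)"
  proof -
    have "(x \<longlongrightarrow> 0) (at 0)"
      unfolding x_def by (rule tendsto_eq_intros refl | simp)+
    \<comment> \<open>Composition along \<open>at 0\<close> needs nonzero values. As
      \<open>b > 0\<close>, the only zeros of \<open>x\<close> are \<open>0\<close> and
      \<open>- 4 * a / b\<close>, also when \<open>a = 0\<close>.\<close>
    moreover have "\<forall>\<^sub>F H in at 0. x H \<noteq> 0"
      using eventually_neq_at_within[of 0 0 UNIV] eventually_neq_at_within[of "- 4 * a / b" 0 UNIV]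
    proof eventually_elim
      case (elim H)
      then have "a + b / 4 * H \<noteq> 0"
        using assms by (auto simp: field_simps)
      then show ?case
        using elim(1) by (simp add: x_def)
    qed
    ultimately show ?thesis
      by (simp add: filterlim_at)
  qed
  have bounded: "f \<in> O[at 0](\<lambda>_. 1)" if "isCont f 0" for f :: "real \<Rightarrow> real"
    using that by (intro bigoI_tendsto[of _ _ "f 0"]) (auto simp: isCont_def)
  have "(\<lambda>H. 1 / sqrt (1 - x H) ^ 3 - P (x H)) \<in> O[at 0](\<lambda>H. x H ^ 4)"
    by (rule landau_o.big.compose[OF series x_at_0])
  also have "(\<lambda>H. x H ^ 4) = (\<lambda>H. H ^ 4 * (a + b / 4 * H) ^ 4)"
    by (simp add: x_def power_mult_distrib)
  also have "\<dots> \<in> O[at 0](\<lambda>H. H ^ 4 * 1)"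
    by (intro landau_o.big.mult bounded) (auto intro!: continuous_intros)
  finally have "(\<lambda>H. (1 / 3 - a * H / 2) * (1 / sqrt (1 - x H) ^ 3 - P (x H))) \<in> O[at 0](\<lambda>H. 1 * H ^ 4)"
    by (intro landau_o.big.mult bounded) (auto intro!: continuous_intros)
  \<comment> \<open>\<open>H ^ 4 * R H\<close> collects the terms of \<open>P (x H)\<close> of order
    at least four.\<close>
  moreover define R where "R = (\<lambda>H. 15 / 8 * (b / 4)\<^sup>2
      + 35 / 16 * (3 * a\<^sup>2 * (b / 4) + 3 * a * (b / 4)\<^sup>2 * H + (b / 4) ^ 3 * H\<^sup>2))"
  \<comment> \<open>The same for \<open>(1 / 3 - a * H / 2) * P (x H)\<close>: the last term is
    \<open>- a / 2\<close> times the cubic coefficient of \<open>P (x H)\<close>.\<close>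
  define Q where "Q = (\<lambda>H. (1 / 3 - a * H / 2) * R H - a / 2 * (15 / 16 * a * b + 35 / 16 * a ^ 3))"
  have "(\<lambda>H. H ^ 4 * Q H) \<in> O[at 0](\<lambda>H. H ^ 4 * 1)"
    unfolding Q_def R_def by (intro landau_o.big.mult bounded) (auto intro!: continuous_intros)
  ultimately have "(\<lambda>H. (1 / 3 - a * H / 2) * (1 / sqrt (1 - x H) ^ 3 - P (x H)) + H ^ 4 * Q H)
      \<in> O[at 0](\<lambda>H. H ^ 4)"
    by (simp add: sum_in_bigo)
  also have "(\<lambda>H. (1 / 3 - a * H / 2) * (1 / sqrt (1 - x H) ^ 3 - P (x H)) + H ^ 4 * Q H)
      = (\<lambda>H. KS_mass a b H - (1 / 3 + (b - a\<^sup>2) / 8 * H\<^sup>2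
        - a * ((2 * a\<^sup>2 - 3 * (b - a\<^sup>2)) / 24) * H ^ 3))"
  proof
    fix H
    have "H ^ 4 * Q H - (1 / 3 - a * H / 2) * P (x H)
        = - (1 / 3 + (b - a\<^sup>2) / 8 * H\<^sup>2 - a * ((2 * a\<^sup>2 - 3 * (b - a\<^sup>2)) / 24) * H ^ 3)"
      unfolding Q_def R_def P_def x_def
      by (simp add: field_simps power2_eq_square power3_eq_cube power4_eq_xxxx)
    moreover have "1 - x H = 1 - a * H - b * H\<^sup>2 / 4"
      by (simp add: x_def algebra_simps power2_eq_square)
    then have "(1 / 3 - a * H / 2) * (1 / sqrt (1 - x H) ^ 3) = KS_mass a b H"
      by (simp only: KS_mass_def times_divide_eq_right mult_1_right)
    ultimately show "(1 / 3 - a * H / 2) * (1 / sqrt (1 - x H) ^ 3 - P (x H)) + H ^ 4 * Q H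
      = KS_mass a b H - (1 / 3 + (b - a\<^sup>2) / 8 * H\<^sup>2
        - a * ((2 * a\<^sup>2 - 3 * (b - a\<^sup>2)) / 24) * H ^ 3)"
      by (simp add: right_diff_distrib)
  qed
  finally show ?thesis .
qed

text \<open>Squaring removes the root from the comparison of the mass with \<open>1 / 3\<close>, leaving the sign of a
  polynomial that is divisible by \<open>H\<^sup>2\<close>, and by \<open>H ^ 3\<close> if \<open>b = a\<^sup>2\<close>.\<close>

lemma eventually_KS_mass_compare:
  "\<forall>\<^sub>F H in at 0. 0 < KS_mass a b H \<and>
     (KS_mass a b H > 1 / 3 \<longleftrightarrow> (1 - a * H - b * H\<^sup>2 / 4) ^ 3 < (1 - 3 / 2 * a * H)\<^sup>2) \<and>
     (KS_mass a b H < 1 / 3 \<longleftrightarrow> (1 - a * H - b * H\<^sup>2 / 4) ^ 3 > (1 - 3 / 2 * a * H)\<^sup>2)"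
proof -
  have "((\<lambda>H. 1 - 3 / 2 * a * H) \<longlongrightarrow> 1) (at 0)"
    by (rule tendsto_eq_intros refl | simp)+
  then have "\<forall>\<^sub>F H in at 0. 0 < 1 - 3 / 2 * a * H"
    by (rule order_tendstoD(1)[OF _ zero_less_one])
  moreover have "\<forall>\<^sub>F H in at 0. 0 < 1 - a * H - b * H\<^sup>2 / 4"
    by (rule order_tendstoD(1)[OF tendsto_KS_mass_denominator zero_less_one])
  ultimately show ?thesis
  proof eventually_elim
    case (elim H)
    \<comment> \<open>The mass is \<open>w / (3 * q ^ 3)\<close>, so the comparison is between the
      positive numbers \<open>w\<close> and \<open>q ^ 3\<close>.\<close>
    define w where "w = 1 - 3 / 2 * a * H"
    define q where "q = sqrt (1 - a * H - b * H\<^sup>2 / 4)"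
    have w: "w > 0" and q: "q > 0" "q\<^sup>2 = 1 - a * H - b * H\<^sup>2 / 4"
      using elim by (simp_all add: w_def q_def)
    have "1 / 3 - a * H / 2 = w / 3"
      by (simp add: w_def)
    then have mass: "KS_mass a b H = w / 3 / q ^ 3"
      by (simp only: KS_mass_def q_def)
    have u: "(1 - a * H - b * H\<^sup>2 / 4) ^ 3 = (q ^ 3)\<^sup>2"
      unfolding q(2)[symmetric] by (simp flip: power_mult)
    have square_less_iff: "x\<^sup>2 < y\<^sup>2 \<longleftrightarrow> x < y" if "x > 0" "y > 0" for x y :: real
      using that power_less_imp_less_base[of x 2 y] power_strict_mono[of x y 2] by auto
    have "q ^ 3 > 0"
      using q(1) by simp
    note square_less_iff[OF this w] square_less_iff[OF w this]
    with w \<open>q ^ 3 > 0\<close> show ?case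
      unfolding u mass w_def[symmetric] by (simp add: divide_less_eq less_divide_eq)
  qed
qed

text \<open>The leading coefficient of the polynomial is \<open>3 / 4 * (b - a\<^sup>2)\<close>.
  When it vanishes, \<open>b > 0\<close> forces \<open>a \<noteq> 0\<close> and the next order
  decides.\<close>

lemma eventually_KS_mass_sign:
  assumes "b > 0"
  shows "b - a\<^sup>2 > 0 \<Longrightarrow> \<forall>\<^sub>F H in at 0. KS_mass a b H > 1 / 3"
    and "b - a\<^sup>2 < 0 \<Longrightarrow> \<forall>\<^sub>F H in at 0. 0 < KS_mass a b H \<and> KS_mass a b H < 1 / 3"
    and "b - a\<^sup>2 = 0 \<Longrightarrow> \<forall>\<^sub>F H in at 0. a * H \<noteq> 0 \<and>
       (a * H > 0 \<longrightarrow> 0 < KS_mass a b H \<and> KS_mass a b H < 1 / 3) \<and>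
       (a * H < 0 \<longrightarrow> KS_mass a b H > 1 / 3)"
proof -
  have nz: "\<forall>\<^sub>F H in at 0. H \<noteq> (0::real)"
    by (rule eventually_neq_at_within)
  \<comment> \<open>The quotient by \<open>H\<^sup>2\<close> of the difference of the two sides
    compared above.\<close>
  define p where "p = (\<lambda>H. 3 / 4 * (b - a\<^sup>2) - 3 / 2 * a * b * H - 3 / 16 * b\<^sup>2 * H\<^sup>2
    + H * (a + b / 4 * H) ^ 3)"
  have p: "(1 - 3 / 2 * a * H)\<^sup>2 - (1 - a * H - b * H\<^sup>2 / 4) ^ 3 = H\<^sup>2 * p H" for H
    unfolding p_def by (simp add: field_simps power2_eq_square power3_eq_cube)
  have p_lim: "(p \<longlongrightarrow> 3 / 4 * (b - a\<^sup>2)) (at 0)"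
    unfolding p_def by (rule tendsto_eq_intros refl | simp)+
  show "\<forall>\<^sub>F H in at 0. KS_mass a b H > 1 / 3" if "b - a\<^sup>2 > 0"
  proof -
    have "\<forall>\<^sub>F H in at 0. p H > 0"
      by (rule order_tendstoD(1)[OF p_lim]) (use that in simp)
    with nz eventually_KS_mass_compare[of a b] show ?thesis
    proof eventually_elim
      case (elim H)
      then have "H\<^sup>2 * p H > 0" by simp
      with elim p[of H] show ?case by linarith
    qed
  qed
  show "\<forall>\<^sub>F H in at 0. 0 < KS_mass a b H \<and> KS_mass a b H < 1 / 3" if "b - a\<^sup>2 < 0"
  proof -
    have "\<forall>\<^sub>F H in at 0. p H < 0"
      by (rule order_tendstoD(2)[OF p_lim]) (use that in simp)
    with nz eventually_KS_mass_compare[of a b] show ?thesis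
    proof eventually_elim
      case (elim H)
      then have "H\<^sup>2 * p H < 0" by (simp add: mult_pos_neg)
      with elim p[of H] show ?case by linarith
    qed
  qed
  show "\<forall>\<^sub>F H in at 0. a * H \<noteq> 0 \<and>
       (a * H > 0 \<longrightarrow> 0 < KS_mass a b H \<and> KS_mass a b H < 1 / 3) \<and>
       (a * H < 0 \<longrightarrow> KS_mass a b H > 1 / 3)" if "b - a\<^sup>2 = 0"
  proof -
    have b: "b = a\<^sup>2" and "a \<noteq> 0"
      using that assms by auto
    \<comment> \<open>For \<open>b = a\<^sup>2\<close> a further factor \<open>H\<close> splits off.
      Multiplying by \<open>a\<^sup>2\<close> exposes \<open>a * H\<close>, and the cofactor tends
      to \<open>- (a\<^sup>2)\<^sup>2 / 2\<close>.\<close>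
    define p' where "p' = (\<lambda>H. a * ((a + b / 4 * H) ^ 3 - 3 / 2 * a * b - 3 / 16 * b\<^sup>2 * H))"
    have p': "a\<^sup>2 * p H = (a * H) * p' H" for H
      unfolding p_def p'_def b by (simp add: field_simps power2_eq_square power3_eq_cube)
    have "(p' \<longlongrightarrow> a * (a ^ 3 - 3 / 2 * a * b)) (at 0)"
      unfolding p'_def by (rule tendsto_eq_intros refl | simp)+
    moreover have "a * (a ^ 3 - 3 / 2 * a * b) = - (a\<^sup>2)\<^sup>2 / 2"
      unfolding b by (simp add: power2_eq_square power3_eq_cube algebra_simps)
    ultimately have "\<forall>\<^sub>F H in at 0. p' H < 0"
      by (elim order_tendstoD(2)) (use \<open>a \<noteq> 0\<close> in simp)
    with nz eventually_KS_mass_compare[of a b] show ?thesis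
    proof eventually_elim
      case (elim H)
      have "H\<^sup>2 * p H < 0" if "a * H > 0"
      proof -
        have "a\<^sup>2 * p H < 0"
          unfolding p' using that elim(3) by (rule mult_pos_neg)
        then show ?thesis
          using elim(1) by (simp add: mult_less_0_iff)
      qed
      moreover have "H\<^sup>2 * p H > 0" if "a * H < 0"
      proof -
        have "a\<^sup>2 * p H > 0"
          unfolding p' using that elim(3) by (rule mult_neg_neg)
        then show ?thesis
          using elim(1) \<open>a \<noteq> 0\<close> by (simp add: zero_less_mult_iff)
      qed
      ultimately show ?case
        using elim p[of H] \<open>a \<noteq> 0\<close> by auto
    qed
  qed
qed

text \<open>A single function \<open>S\<close> serves all solutions and both ranges of
  \<open>\<mu>\<close>. The existence clause rules out vacuous truth of the isometry claim.\<close>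

theorem mainTheorem3:
  fixes \<Phi>0 \<Phi>0' \<sigma>0 :: real
  assumes "\<Phi>0 > 0" and "\<sigma>0 = \<Phi>0\<^sup>2 - \<Phi>0'\<^sup>2"
  shows "\<exists>S :: real \<Rightarrow> real.
    (\<forall>\<^sub>F H in at 0.
       (\<exists>J F G. KS_perturbation \<Phi>0 \<Phi>0' H J F G) \<and>
       (\<forall>J F G. KS_perturbation \<Phi>0 \<Phi>0' H J F G \<longrightarrow>
          locally_isometric_to (EF_circle J F G) (schwarzschild_de_sitter (S H)) \<and>
          locally_isometric_to (EF_line J F G) (schwarzschild_de_sitter (S H)))) \<and>
    (\<lambda>H. S H - (1 / 3 + \<sigma>0 / 8 * H\<^sup>2 - \<Phi>0' * ((2 * \<Phi>0'\<^sup>2 - 3 * \<sigma>0) / 24) * H ^ 3))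
      \<in> O[at 0](\<lambda>H. H ^ 4) \<and>
    (\<sigma>0 > 0 \<longrightarrow> (\<forall>\<^sub>F H in at 0. S H > 1 / 3)) \<and>
    (\<sigma>0 < 0 \<longrightarrow> (\<forall>\<^sub>F H in at 0. 0 < S H \<and> S H < 1 / 3)) \<and>
    (\<sigma>0 = 0 \<longrightarrow> (\<forall>\<^sub>F H in at 0.
       \<Phi>0' * H \<noteq> 0 \<and>
       (\<Phi>0' * H > 0 \<longrightarrow> 0 < S H \<and> S H < 1 / 3) \<and>
       (\<Phi>0' * H < 0 \<longrightarrow> S H > 1 / 3)))"
proof -
  have pos: "\<Phi>0\<^sup>2 > 0"
    using assms(1) by simp
  have "\<forall>\<^sub>F H in at 0. 0 < 1 - \<Phi>0' * H - \<Phi>0\<^sup>2 * H\<^sup>2 / 4"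
    by (rule order_tendstoD(1)[OF tendsto_KS_mass_denominator zero_less_one])
  moreover have "\<forall>\<^sub>F H in at 0. H \<noteq> (0::real)"
    by (rule eventually_neq_at_within)
  ultimately have "\<forall>\<^sub>F H in at 0.
       (\<exists>J F G. KS_perturbation \<Phi>0 \<Phi>0' H J F G) \<and>
       (\<forall>J F G. KS_perturbation \<Phi>0 \<Phi>0' H J F G \<longrightarrow>
          locally_isometric_to (EF_circle J F G) (schwarzschild_de_sitter (KS_mass \<Phi>0' (\<Phi>0\<^sup>2) H)) \<and>
          locally_isometric_to (EF_line J F G) (schwarzschild_de_sitter (KS_mass \<Phi>0' (\<Phi>0\<^sup>2) H)))"
    by eventually_elim (blast intro: KS_perturbation_exists KS_perturbation_locally_isometric)
  then show ?thesis
    unfolding assms(2)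
    using KS_mass_asymptotics[OF pos, of \<Phi>0'] eventually_KS_mass_sign[OF pos, of \<Phi>0']
    by (intro exI[of _ "KS_mass \<Phi>0' (\<Phi>0\<^sup>2)"] conjI impI)
qed

end
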